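(* The pure cactus group $PJ_4$ of degree four admits the presentation \[ \left\langle \alpha_1, \alpha_2, \alpha_3, \alpha_4, \alpha_5 \;\middle|\; \alpha_1^2 \alpha_2^2 \alpha_3^2 \alpha_4^2 \alpha_5^2 = e \right\rangle . \]
   Context: For an integer $n\ge 2$, the cactus group $J_n$ is the group generated by $s_{p,q}$ for $1\le p<q\le n$ subject to the relations: (1) $s_{p,q}^2=e$ for all $1\le p<q\le n$; (2) $s_{p,q}s_{m,r}=s_{m,r}s_{p,q}$ whenever $[p,q]\cap[m,r]=\emptyset$; (3) $s_{p,q}s_{m,r}=s_{p+q-r,\,p+q-m}\,s_{p,q}$ whenever $[m,r]\subset[p,q]$. Here $[p,q]=\{p,p+1,\dots,q\}$ and $e$ is the identity. There is a natural surjective homomorphism $\pi:J_n\to S_n$ sending $s_{p,q}$ to the permutation that reverses the order of $p,p+1,\dots,q$ (i.e. $i\mapsto p+q-i$ for $i \in [p,q]$) and fixes all other elements. The pure cactus group of degree $n$ is $PJ_n=\ker \pi$. The presentation in the claim is that of the fundamental group of the connected sum of five real projective planes. *)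

theory Defs
  imports "HOL-Algebra.Sym_Groups" "HOL-Algebra.Coset"
begin

section \<open>Groups given by generators and relations\<close>

text \<open>
  A letter \<open>(x, True)\<close> stands for the generator \<open>x\<close> and \<open>(x, False)\<close> for its formal inverse.
  A relation \<open>(u, v)\<close> stands for the equation \<open>u = v\<close>.
\<close>

type_synonym 'a gword = "('a \<times> bool) list"

definition gwords :: "'a set \<Rightarrow> 'a gword set"
  where "gwords S = lists (S \<times> UNIV)"

abbreviation gen :: "'a \<Rightarrow> 'a gword"
  where "gen x \<equiv> [(x, True)]"

inductive_set presentation_cong ::
    "'a set \<Rightarrow> ('a gword \<times> 'a gword) set \<Rightarrow> ('a gword \<times> 'a gword) set"
  for S R
where
  refl: "w \<in> gwords S \<Longrightarrow> (w, w) \<in> presentation_cong S R"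
| sym: "(u, v) \<in> presentation_cong S R \<Longrightarrow> (v, u) \<in> presentation_cong S R"
| trans: "(u, v) \<in> presentation_cong S R \<Longrightarrow> (v, w) \<in> presentation_cong S R \<Longrightarrow>
    (u, w) \<in> presentation_cong S R"
| append: "(u, u') \<in> presentation_cong S R \<Longrightarrow> (v, v') \<in> presentation_cong S R \<Longrightarrow>
    (u @ v, u' @ v') \<in> presentation_cong S R"
| cancel: "x \<in> S \<Longrightarrow> ([(x, b), (x, \<not> b)], []) \<in> presentation_cong S R"
| rel: "(u, v) \<in> R \<Longrightarrow> u \<in> gwords S \<Longrightarrow> v \<in> gwords S \<Longrightarrow> (u, v) \<in> presentation_cong S R"

definition presented_group ::
    "'a set \<Rightarrow> ('a gword \<times> 'a gword) set \<Rightarrow> 'a gword set monoid"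
  where "presented_group S R =
    \<lparr>carrier = gwords S // presentation_cong S R,
     mult = (\<lambda>A B. \<Union>u\<in>A. \<Union>v\<in>B. presentation_cong S R `` {u @ v}),
     one = presentation_cong S R `` {[]}\<rparr>"

fun gword_eval :: "('b, 'm) monoid_scheme \<Rightarrow> ('a \<Rightarrow> 'b) \<Rightarrow> 'a gword \<Rightarrow> 'b"
  where
    "gword_eval G f [] = \<one>\<^bsub>G\<^esub>"
  | "gword_eval G f ((x, b) # w) = (if b then f x else inv\<^bsub>G\<^esub> (f x)) \<otimes>\<^bsub>G\<^esub> gword_eval G f w"

text \<open>
  The homomorphism out of a presented group that extends \<open>f\<close>. It is meaningful only when \<open>f\<close>
  respects the relations; then evaluation is constant on each class, see
  \<open>presentation_lift_class\<close> and \<open>presentation_lift_hom\<close> below.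
\<close>

definition presentation_lift :: "('b, 'm) monoid_scheme \<Rightarrow> ('a \<Rightarrow> 'b) \<Rightarrow> 'a gword set \<Rightarrow> 'b"
  where "presentation_lift G f A = the_elem (gword_eval G f ` A)"

lemma gwords_Nil [simp]: "[] \<in> gwords S"
  by (simp add: gwords_def)

lemma gwords_append [simp]: "u @ v \<in> gwords S \<longleftrightarrow> u \<in> gwords S \<and> v \<in> gwords S"
  by (auto simp: gwords_def)

lemma gwords_Cons [simp]: "(x, b) # w \<in> gwords S \<longleftrightarrow> x \<in> S \<and> w \<in> gwords S"
  by (auto simp: gwords_def)

lemma presentation_cong_gwords:
  "(u, v) \<in> presentation_cong S R \<Longrightarrow> u \<in> gwords S \<and> v \<in> gwords S"
  by (induction rule: presentation_cong.induct) auto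

lemma equiv_presentation_cong: "equiv (gwords S) (presentation_cong S R)"
proof (rule equivI)
  show "presentation_cong S R \<subseteq> gwords S \<times> gwords S"
    using presentation_cong_gwords by fastforce
  show "refl_on (gwords S) (presentation_cong S R)"
    by (auto simp: refl_on_def intro: presentation_cong.refl)
  show "Relation.sym (presentation_cong S R)"
    by (auto simp: sym_def intro: presentation_cong.sym)
  show "Relation.trans (presentation_cong S R)"
    by (auto simp: trans_def intro: presentation_cong.trans)
qed

lemma presented_group_mult_class:
  assumes "u \<in> gwords S" "v \<in> gwords S"
  shows "presentation_cong S R `` {u} \<otimes>\<^bsub>presented_group S R\<^esub> presentation_cong S R `` {v} =
    presentation_cong S R `` {u @ v}"
proof -
  have "presentation_cong S R `` {u' @ v'} = presentation_cong S R `` {u @ v}"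
    if "(u, u') \<in> presentation_cong S R" "(v, v') \<in> presentation_cong S R" for u' v'
    using that equiv_class_eq[OF equiv_presentation_cong] presentation_cong.append
      presentation_cong.sym by metis
  then have "(\<Union>u'\<in>presentation_cong S R `` {u}. \<Union>v'\<in>presentation_cong S R `` {v}.
      presentation_cong S R `` {u' @ v'}) =
    (\<Union>u'\<in>presentation_cong S R `` {u}. \<Union>v'\<in>presentation_cong S R `` {v}.
      presentation_cong S R `` {u @ v})"
    by (intro SUP_cong HOL.refl) blast
  also have "\<dots> = presentation_cong S R `` {u @ v}"
    using presentation_cong.refl[OF assms(1)] presentation_cong.refl[OF assms(2)] by blast
  finally show ?thesis
    by (simp only: presented_group_def monoid.simps)
qed

lemma presented_group_carrier_cases:
  assumes "A \<in> carrier (presented_group S R)"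
  obtains w where "w \<in> gwords S" "A = presentation_cong S R `` {w}"
  using assms by (auto simp: presented_group_def elim: quotientE)

lemma presented_group_class_in_carrier:
  "w \<in> gwords S \<Longrightarrow> presentation_cong S R `` {w} \<in> carrier (presented_group S R)"
  by (simp add: presented_group_def quotientI)

lemma gword_left_inverse:
  "w \<in> gwords S \<Longrightarrow> \<exists>w' \<in> gwords S. (w' @ w, []) \<in> presentation_cong S R"
proof (induction w)
  case Nil
  then show ?case by (force intro: presentation_cong.refl)
next
  case (Cons a w)
  obtain x b where a: "a = (x, b)" by force
  with Cons obtain w' where w': "w' \<in> gwords S" "(w' @ w, []) \<in> presentation_cong S R"
    by auto
  have x: "x \<in> S" and w: "w \<in> gwords S" using Cons.prems a by auto
  have "([(x, \<not> b), (x, b)] @ w, [] @ w) \<in> presentation_cong S R"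
    using presentation_cong.append[OF presentation_cong.cancel[OF x, of "\<not> b"]
        presentation_cong.refl[OF w]] by simp
  from presentation_cong.append[OF presentation_cong.refl[OF w'(1)] this]
  have "((w' @ [(x, \<not> b)]) @ a # w, w' @ w) \<in> presentation_cong S R"
    using a by simp
  with w' have "((w' @ [(x, \<not> b)]) @ a # w, []) \<in> presentation_cong S R"
    by (blast intro: presentation_cong.trans)
  moreover have "w' @ [(x, \<not> b)] \<in> gwords S" using w' x by simp
  ultimately show ?case by blast
qed

lemma group_presented_group: "group (presented_group S R)"
proof (rule groupI)
  let ?G = "presented_group S R"
  have one: "\<one>\<^bsub>?G\<^esub> = presentation_cong S R `` {[]}" by (simp add: presented_group_def)
  show "\<one>\<^bsub>?G\<^esub> \<in> carrier ?G"
    by (simp add: one presented_group_class_in_carrier)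
  fix A assume A: "A \<in> carrier ?G"
  then obtain u where u: "u \<in> gwords S" "A = presentation_cong S R `` {u}"
    by (rule presented_group_carrier_cases)
  show "\<one>\<^bsub>?G\<^esub> \<otimes>\<^bsub>?G\<^esub> A = A"
    using u by (simp add: one presented_group_mult_class)
  obtain u' where u': "u' \<in> gwords S" "(u' @ u, []) \<in> presentation_cong S R"
    using gword_left_inverse u by blast
  then have "presentation_cong S R `` {u'} \<otimes>\<^bsub>?G\<^esub> A = \<one>\<^bsub>?G\<^esub>"
    using u equiv_class_eq[OF equiv_presentation_cong]
    by (simp add: one presented_group_mult_class)
  then show "\<exists>B\<in>carrier ?G. B \<otimes>\<^bsub>?G\<^esub> A = \<one>\<^bsub>?G\<^esub>"
    using u' presented_group_class_in_carrier by blast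
  fix B assume B: "B \<in> carrier ?G"
  then obtain v where v: "v \<in> gwords S" "B = presentation_cong S R `` {v}"
    by (rule presented_group_carrier_cases)
  show "A \<otimes>\<^bsub>?G\<^esub> B \<in> carrier ?G"
    using u v by (simp add: presented_group_mult_class presented_group_class_in_carrier)
  fix C assume C: "C \<in> carrier ?G"
  then obtain w where w: "w \<in> gwords S" "C = presentation_cong S R `` {w}"
    by (rule presented_group_carrier_cases)
  show "A \<otimes>\<^bsub>?G\<^esub> B \<otimes>\<^bsub>?G\<^esub> C = A \<otimes>\<^bsub>?G\<^esub> (B \<otimes>\<^bsub>?G\<^esub> C)"
    using u v w by (simp add: presented_group_mult_class)
qed

context group
begin

lemma gword_eval_closed:
  assumes "\<And>x. x \<in> S \<Longrightarrow> f x \<in> carrier G"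
  shows "w \<in> gwords S \<Longrightarrow> gword_eval G f w \<in> carrier G"
proof (induction w)
  case (Cons a w)
  then show ?case using assms by (cases a) auto
qed simp

lemma gword_eval_append:
  assumes "\<And>x. x \<in> S \<Longrightarrow> f x \<in> carrier G" "v \<in> gwords S"
  shows "u \<in> gwords S \<Longrightarrow> gword_eval G f (u @ v) = gword_eval G f u \<otimes> gword_eval G f v"
proof (induction u)
  case Nil
  then show ?case using gword_eval_closed[OF assms] by simp
next
  case (Cons a u)
  then show ?case
    using assms gword_eval_closed[of S f] by (cases a) (auto simp: m_assoc)
qed

lemma gword_eval_cong:
  assumes f: "\<And>x. x \<in> S \<Longrightarrow> f x \<in> carrier G"
    and R: "\<And>u v. (u, v) \<in> R \<Longrightarrow> gword_eval G f u = gword_eval G f v"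
  shows "(u, v) \<in> presentation_cong S R \<Longrightarrow> gword_eval G f u = gword_eval G f v"
proof (induction rule: presentation_cong.induct)
  case (append u u' v v')
  then have "u \<in> gwords S" "v \<in> gwords S" "u' \<in> gwords S" "v' \<in> gwords S"
    using presentation_cong_gwords by blast+
  then show ?case
    using append.IH gword_eval_append[of S f v u] gword_eval_append[of S f v' u'] f by simp
next
  case (cancel x b)
  then show ?case using f by (cases b) auto
next
  case (rel u v)
  then show ?case using R by blast
qed simp_all

lemma presentation_lift_class:
  assumes f: "\<And>x. x \<in> S \<Longrightarrow> f x \<in> carrier G"
    and R: "\<And>u v. (u, v) \<in> R \<Longrightarrow> gword_eval G f u = gword_eval G f v"
    and w: "w \<in> gwords S"
  shows "presentation_lift G f (presentation_cong S R `` {w}) = gword_eval G f w"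
proof -
  have "gword_eval G f ` (presentation_cong S R `` {w}) = {gword_eval G f w}"
  proof (intro equalityI subsetI)
    fix y assume "y \<in> gword_eval G f ` (presentation_cong S R `` {w})"
    then obtain w' where "(w, w') \<in> presentation_cong S R" "y = gword_eval G f w'" by blast
    with gword_eval_cong[OF f R this(1)] show "y \<in> {gword_eval G f w}" by simp
  qed (use presentation_cong.refl[OF w] in blast)
  then show ?thesis by (simp add: presentation_lift_def)
qed

lemma presentation_lift_hom:
  assumes f: "\<And>x. x \<in> S \<Longrightarrow> f x \<in> carrier G"
    and R: "\<And>u v. (u, v) \<in> R \<Longrightarrow> gword_eval G f u = gword_eval G f v"
  shows "presentation_lift G f \<in> hom (presented_group S R) G"
proof (rule homI)
  have closed: "gword_eval G f w \<in> carrier G" if "w \<in> gwords S" for w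
    using gword_eval_closed f that by blast
  have app: "gword_eval G f (u @ v) = gword_eval G f u \<otimes> gword_eval G f v"
    if "u \<in> gwords S" "v \<in> gwords S" for u v
    using gword_eval_append f that by blast
  have cls: "presentation_lift G f (presentation_cong S R `` {w}) = gword_eval G f w"
    if "w \<in> gwords S" for w
    by (rule presentation_lift_class) (fact f R that)+
  fix A assume "A \<in> carrier (presented_group S R)"
  then obtain u where u: "u \<in> gwords S" "A = presentation_cong S R `` {u}"
    by (rule presented_group_carrier_cases)
  then show "presentation_lift G f A \<in> carrier G"
    by (simp add: cls closed)
  fix B assume "B \<in> carrier (presented_group S R)"
  then obtain v where v: "v \<in> gwords S" "B = presentation_cong S R `` {v}"
    by (rule presented_group_carrier_cases)
  show "presentation_lift G f (A \<otimes>\<^bsub>presented_group S R\<^esub> B) =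
      presentation_lift G f A \<otimes> presentation_lift G f B"
    using u v by (simp add: cls app presented_group_mult_class)
qed

end


section \<open>Cactus groups\<close>

definition cactus_gens :: "nat \<Rightarrow> (nat \<times> nat) set"
  where "cactus_gens n = {(p, q). 1 \<le> p \<and> p < q \<and> q \<le> n}"

definition cactus_rels :: "nat \<Rightarrow> ((nat \<times> nat) gword \<times> (nat \<times> nat) gword) set"
  where "cactus_rels n =
    {(gen (p, q) @ gen (p, q), []) | p q. (p, q) \<in> cactus_gens n} \<union>
    {(gen (p, q) @ gen (m, r), gen (m, r) @ gen (p, q)) | p q m r.
      (p, q) \<in> cactus_gens n \<and> (m, r) \<in> cactus_gens n \<and> {p..q} \<inter> {m..r} = {}} \<union>
    {(gen (p, q) @ gen (m, r), gen (p + q - r, p + q - m) @ gen (p, q)) | p q m r.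
      (p, q) \<in> cactus_gens n \<and> (m, r) \<in> cactus_gens n \<and> {m..r} \<subseteq> {p..q}}"

definition cactus_group :: "nat \<Rightarrow> (nat \<times> nat) gword set monoid"
  where "cactus_group n = presented_group (cactus_gens n) (cactus_rels n)"

definition interval_reversal :: "nat \<times> nat \<Rightarrow> nat \<Rightarrow> nat"
  where "interval_reversal = (\<lambda>(p, q) i. if i \<in> {p..q} then p + q - i else i)"

definition cactus_to_sym :: "nat \<Rightarrow> (nat \<times> nat) gword set \<Rightarrow> nat \<Rightarrow> nat"
  where "cactus_to_sym n = presentation_lift (sym_group n) interval_reversal"

definition pure_cactus_group :: "nat \<Rightarrow> (nat \<times> nat) gword set monoid"
  where "pure_cactus_group n =
    (cactus_group n)\<lparr>carrier := kernel (cactus_group n) (sym_group n) (cactus_to_sym n)\<rparr>"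

lemma interval_reversal_permutes:
  assumes "(p, q) \<in> cactus_gens n"
  shows "interval_reversal (p, q) permutes {1..n}"
proof (rule bij_imp_permutes)
  show "bij_betw (interval_reversal (p, q)) {1..n} {1..n}"
    by (rule bij_betwI[where g = "interval_reversal (p, q)"])
      (use assms in \<open>auto simp: interval_reversal_def cactus_gens_def\<close>)
qed (use assms in \<open>auto simp: interval_reversal_def cactus_gens_def\<close>)

lemma interval_reversal_respects_rels:
  assumes "(u, v) \<in> cactus_rels n"
  shows "gword_eval (sym_group n) interval_reversal u = gword_eval (sym_group n) interval_reversal v"
proof -
  have 1: "interval_reversal (p, q) \<circ> interval_reversal (p, q) = id" for p q
    by (auto simp: fun_eq_iff interval_reversal_def)
  have 2: "interval_reversal (p, q) \<circ> interval_reversal (m, r) =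
      interval_reversal (m, r) \<circ> interval_reversal (p, q)"
    if D: "{p..q} \<inter> {m..r} = {}" for p q m r
  proof
    fix i
    have P: "p + q - i \<in> {p..q}" if "i \<in> {p..q}" using that by auto
    have M: "m + r - i \<in> {m..r}" if "i \<in> {m..r}" using that by auto
    consider "i \<in> {p..q}" "i \<notin> {m..r}" | "i \<in> {m..r}" "i \<notin> {p..q}"
      | "i \<notin> {p..q}" "i \<notin> {m..r}" using D by blast
    then show "(interval_reversal (p, q) \<circ> interval_reversal (m, r)) i =
      (interval_reversal (m, r) \<circ> interval_reversal (p, q)) i"
    proof cases
      case 1
      then have "p + q - i \<notin> {m..r}" using P D by blast
      with 1 show ?thesis by (simp only: interval_reversal_def o_def split if_True if_False)
    next
      case 2
      then have "m + r - i \<notin> {p..q}" using M D by blast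
      with 2 show ?thesis by (simp only: interval_reversal_def o_def split if_True if_False)
    next
      case 3
      then show ?thesis by (simp only: interval_reversal_def o_def split if_True if_False)
    qed
  qed
  have 3: "interval_reversal (p, q) \<circ> interval_reversal (m, r) =
      interval_reversal (p + q - r, p + q - m) \<circ> interval_reversal (p, q)"
    if "m < r" "{m..r} \<subseteq> {p..q}" for p q m r
    using that by (auto simp: fun_eq_iff interval_reversal_def)
  show ?thesis
    using assms unfolding cactus_rels_def
  proof (elim UnE CollectE exE conjE Pair_inject)
    fix p q m r
    assume "u = gen (p, q) @ gen (m, r)" "v = gen (p + q - r, p + q - m) @ gen (p, q)"
      "(m, r) \<in> cactus_gens n" "{m..r} \<subseteq> {p..q}"
    moreover from this have "m < r" by (simp add: cactus_gens_def)
    ultimately show ?thesis using 3[of m r p q] by (simp add: sym_group_def del: o_apply)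
  qed (use 1 2 in \<open>simp_all add: sym_group_def\<close>)
qed

lemma cactus_to_sym_hom: "cactus_to_sym n \<in> hom (cactus_group n) (sym_group n)"
  unfolding cactus_to_sym_def cactus_group_def
  by (rule group.presentation_lift_hom[OF sym_group_is_group])
    (auto simp: sym_group_carrier interval_reversal_permutes simp del: One_nat_def dest: interval_reversal_respects_rels)

lemma cactus_to_sym_gen:
  assumes "(p, q) \<in> cactus_gens n"
  shows "cactus_to_sym n (presentation_cong (cactus_gens n) (cactus_rels n) `` {gen (p, q)}) =
    interval_reversal (p, q)"
proof -
  have carr: "interval_reversal x \<in> carrier (sym_group n)" if "x \<in> cactus_gens n" for x
    using that by (cases x) (simp add: sym_group_carrier interval_reversal_permutes del: One_nat_def)
  have gen: "gen (p, q) \<in> gwords (cactus_gens n)" using assms by simp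
  have "cactus_to_sym n (presentation_cong (cactus_gens n) (cactus_rels n) `` {gen (p, q)}) =
      gword_eval (sym_group n) interval_reversal (gen (p, q))"
    unfolding cactus_to_sym_def
    by (rule group.presentation_lift_class[OF sym_group_is_group])
      (fact carr interval_reversal_respects_rels gen)+
  then show ?thesis by (simp add: sym_group_def)
qed

lemma group_cactus_group: "group (cactus_group n)"
  by (simp add: cactus_group_def group_presented_group)

lemma cactus_to_sym_epi: "cactus_to_sym n \<in> epi (cactus_group n) (sym_group n)"
proof -
  interpret group_hom "cactus_group n" "sym_group n" "cactus_to_sym n"
    by (intro group_hom.intro group_hom_axioms.intro group_cactus_group sym_group_is_group
        cactus_to_sym_hom)
  let ?I = "cactus_to_sym n ` carrier (cactus_group n)"
  have comp: "f \<circ> g \<in> ?I" if "f \<in> ?I" "g \<in> ?I" for f g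
    using subgroup.m_closed[OF img_is_subgroup that] by (simp add: sym_group_mult)
  have id: "id \<in> ?I"
    using subgroup.one_closed[OF img_is_subgroup] by (simp add: sym_group_one)
  have rev: "interval_reversal (p, q) \<in> ?I" if "(p, q) \<in> cactus_gens n" for p q
    using cactus_to_sym_gen[OF that] that
      presented_group_class_in_carrier[of "gen (p, q)" "cactus_gens n" "cactus_rels n"]
    by (metis cactus_group_def gwords_Cons gwords_Nil imageI)
  have transp: "transpose a b \<in> ?I" if "1 \<le> a" "a < b" "b \<le> n" for a b :: nat
  proof (cases "a + 1 < b - 1")
    case True
    have "transpose a b = interval_reversal (a, b) \<circ> interval_reversal (a + 1, b - 1)"
      using True by (auto simp: fun_eq_iff interval_reversal_def transpose_def)
    moreover have "(a, b) \<in> cactus_gens n" "(a + 1, b - 1) \<in> cactus_gens n"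
      using that True by (auto simp: cactus_gens_def)
    ultimately show ?thesis using rev comp by simp
  next
    case False
    have "transpose a b = interval_reversal (a, b)"
      using False that by (auto simp: fun_eq_iff interval_reversal_def transpose_def)
    then show ?thesis using rev that by (simp add: cactus_gens_def)
  qed
  have "p \<in> ?I" if "p permutes {1..n}" for p
    using that finite_atLeastAtMost
  proof (induction rule: permutes_induct)
    case id
    show ?case using \<open>id \<in> ?I\<close> .
  next
    case (swap a b p)
    have "transpose a b \<in> ?I"
      using swap.hyps transp[of a b] transp[of b a]
      by (cases a b rule: linorder_cases) (auto simp: transpose_commute)
    then show ?case using comp swap.IH by blast
  qed
  then show ?thesis
    using cactus_to_sym_hom by (auto simp: epi_def sym_group_carrier hom_def)
qed

lemma group_pure_cactus_group: "group (pure_cactus_group n)"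
proof -
  interpret group_hom "cactus_group n" "sym_group n" "cactus_to_sym n"
    by (intro group_hom.intro group_hom_axioms.intro group_cactus_group sym_group_is_group
        cactus_to_sym_hom)
  show ?thesis
    unfolding pure_cactus_group_def
    by (rule subgroup.subgroup_is_group[OF subgroup_kernel group_cactus_group])
qed

end

theory Submission
  imports Defs
begin

text \<open>
  \<open>J\<^sub>4\<close> acts on the 24 orderings of \<open>{1, 2, 3, 4}\<close> by reversing segments, and \<open>PJ\<^sub>4\<close> is the
  stabiliser of the standard ordering, i.e. the fundamental group of the covering of the presentation
  complex of \<open>J\<^sub>4\<close> with these 24 sheets. Here \<open>J\<^sub>4\<close> is generated by \<open>a = s\<^bsub>1,2\<^esub>\<close>,
  \<open>b = s\<^bsub>1,3\<^esub>\<close>, \<open>c = s\<^bsub>1,4\<^esub>\<close> with relators \<open>a\<^sup>2\<close>, \<open>b\<^sup>2\<close>, \<open>c\<^sup>2\<close>, \<open>(ac)\<^sup>4\<close>, \<open>(abcb)\<^sup>2\<close>.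
  Merging the faces of the covering that have the same boundary gives a closed surface. Its edges of
  type \<open>a\<close> and \<open>c\<close> form three octagons, which bound and may be contracted; the twelve \<open>b\<close>-edges
  are glued by six squares. Two of the \<open>b\<close>-edges complete a spanning tree, and eliminating five of
  the remaining ten with five of the squares leaves a single decagon, brought to the form
  \<open>\<alpha>\<^sub>1\<^sup>2 \<cdots> \<alpha>\<^sub>5\<^sup>2\<close> by cutting and pasting.

  The outcome is a word in the \<open>\<alpha>\<^sub>i\<close> (a holonomy) for each edge and a loop in \<open>J\<^sub>4\<close> for each
  \<open>\<alpha>\<^sub>i\<close>. That the two assignments respect the relations and are mutually inverse is a finite
  collection of word identities.
\<close>

section \<open>Words over a presentation\<close>

definition gword_inv :: "'a gword \<Rightarrow> 'a gword"
  where "gword_inv w = rev (map (\<lambda>(x, b). (x, \<not> b)) w)"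

lemma gword_inv_simps [simp]:
  "gword_inv [] = []"
  "gword_inv ((x, b) # w) = gword_inv w @ [(x, \<not> b)]"
  by (simp_all add: gword_inv_def)

lemma gword_inv_closed [simp]: "gword_inv w \<in> gwords S \<longleftrightarrow> w \<in> gwords S"
  by (induction w) auto

context
  fixes S :: "'a set" and R :: "('a gword \<times> 'a gword) set"
begin

private abbreviation (input) cong_word (infix "\<approx>" 50)
  where "u \<approx> v \<equiv> (u, v) \<in> presentation_cong S R"

lemma presentation_cong_context:
  assumes "u \<approx> v" "x \<in> gwords S" "y \<in> gwords S"
  shows "x @ u @ y \<approx> x @ v @ y"
  by (intro presentation_cong.append presentation_cong.refl assms)

lemma gword_inv_right: "w \<in> gwords S \<Longrightarrow> w @ gword_inv w \<approx> []"
proof (induction w)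
  case (Cons a w)
  obtain x b where a: "a = (x, b)" by (cases a)
  have x: "x \<in> S" and w: "w \<in> gwords S" using Cons.prems a by auto
  have "[(x, b)] @ (w @ gword_inv w) @ [(x, \<not> b)] \<approx> [(x, b)] @ [] @ [(x, \<not> b)]"
    using Cons.IH w x by (intro presentation_cong_context) auto
  then show ?case
    using presentation_cong.cancel[OF x, where R = R and b = b] a by simp (erule (1) presentation_cong.trans)
qed (simp add: presentation_cong.refl)

lemma gword_inv_left: "w \<in> gwords S \<Longrightarrow> gword_inv w @ w \<approx> []"
proof (induction w)
  case (Cons a w)
  obtain x b where a: "a = (x, b)" by (cases a)
  have x: "x \<in> S" and w: "w \<in> gwords S" using Cons.prems a by auto
  have "gword_inv w @ [(x, \<not> b), (x, b)] @ w \<approx> gword_inv w @ [] @ w"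
    using presentation_cong.cancel[OF x, where R = R and b = "\<not> b"] w
    by (intro presentation_cong_context) auto
  then show ?case
    using Cons.IH[OF w] a by simp (erule (1) presentation_cong.trans)
qed (simp add: presentation_cong.refl)

text \<open>Reduces an equation of words to the triviality of one word, the form that the evaluated
  checks treat: \<open>u @ gword_inv v @ v\<close> is congruent to both sides.\<close>

lemma presentation_cong_if_quotient_trivial:
  assumes "u @ gword_inv v \<approx> []" "u \<in> gwords S" "v \<in> gwords S"
  shows "u \<approx> v"
proof -
  have "u @ gword_inv v @ v \<approx> u"
    using presentation_cong_context[OF gword_inv_left[OF assms(3)] assms(2), of "[]"] by simp
  moreover have "u @ gword_inv v @ v \<approx> v"
    using presentation_cong.append[OF assms(1) presentation_cong.refl[OF assms(3)]] by simp
  ultimately show ?thesis by (blast intro: presentation_cong.sym presentation_cong.trans)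
qed

text \<open>\<open>u @ v\<close> is the conjugate of \<open>v @ u\<close> by
  \<open>u\<close>.\<close>

lemma presentation_cong_rotate:
  assumes "v @ u \<approx> []" "u \<in> gwords S" "v \<in> gwords S"
  shows "u @ v \<approx> []"
proof -
  have "u @ v \<approx> u @ v @ (u @ gword_inv u)"
    using presentation_cong.append[OF presentation_cong.refl presentation_cong.sym[OF gword_inv_right]]
      assms(2,3) by (metis append.right_neutral append_assoc gwords_append)
  also have "u @ v @ (u @ gword_inv u) = u @ (v @ u) @ gword_inv u" by simp
  finally have "u @ v \<approx> u @ (v @ u) @ gword_inv u" .
  moreover have "u @ (v @ u) @ gword_inv u \<approx> u @ [] @ gword_inv u"
    using assms by (intro presentation_cong_context) auto
  moreover have "u @ [] @ gword_inv u \<approx> []" using gword_inv_right assms by simp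
  ultimately show ?thesis by (blast intro: presentation_cong.trans)
qed

end

section \<open>Free reduction and conjugates of a relator\<close>

fun free_cons :: "'a \<times> bool \<Rightarrow> 'a gword \<Rightarrow> 'a gword"
  where
    "free_cons a [] = [a]"
  | "free_cons (x, b) ((y, c) # w) = (if x = y \<and> b \<noteq> c then w else (x, b) # (y, c) # w)"

definition free_reduce :: "'a gword \<Rightarrow> 'a gword"
  where "free_reduce w = foldr free_cons w []"

lemma free_cons_cong:
  assumes "a # w \<in> gwords S"
  shows "(a # w, free_cons a w) \<in> presentation_cong S R"
proof (cases "free_cons a w = a # w")
  case True
  then show ?thesis using presentation_cong.refl[OF assms, of R] by simp
next
  case False
  obtain x b where a: "a = (x, b)" by (cases a)
  from False obtain y c w' where w: "w = (y, c) # w'" by (cases w) auto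
  with False a have yc: "y = x" "c = (\<not> b)" by (simp_all split: if_splits)
  have "([(x, b), (x, \<not> b)] @ w', [] @ w') \<in> presentation_cong S R"
    using assms a w by (intro presentation_cong.append presentation_cong.cancel presentation_cong.refl) auto
  then show ?thesis using a w yc by simp
qed

lemma free_reduce_cong: "w \<in> gwords S \<Longrightarrow> (w, free_reduce w) \<in> presentation_cong S R"
proof (induction w)
  case (Cons a w)
  have "[a] \<in> gwords S" "w \<in> gwords S" using Cons.prems by (cases a; simp)+
  with Cons.IH have "([a] @ w, [a] @ free_reduce w) \<in> presentation_cong S R"
    by (intro presentation_cong.append presentation_cong.refl)
  moreover from presentation_cong_gwords[OF this]
  have "(a # free_reduce w, free_cons a (free_reduce w)) \<in> presentation_cong S R"
    by (intro free_cons_cong) simp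
  ultimately show ?case by (simp add: free_reduce_def) (erule (1) presentation_cong.trans)
qed (simp add: free_reduce_def presentation_cong.refl)

definition relator_conjugate :: "'a gword \<Rightarrow> 'a gword \<Rightarrow> bool"
  where "relator_conjugate r w \<longleftrightarrow>
    (if free_reduce w = [] then True
     else \<exists>k\<in>set [0..<length w]. free_reduce (rotate k w) \<in> {r, gword_inv r})"

lemma relator_conjugate_trivial:
  assumes "relator_conjugate r w" "w \<in> gwords S" "(r, []) \<in> presentation_cong S R"
  shows "(w, []) \<in> presentation_cong S R"
proof -
  have r: "r \<in> gwords S" using presentation_cong_gwords assms(3) by blast
  have "([] @ gword_inv r, r @ gword_inv r) \<in> presentation_cong S R"
    using presentation_cong.sym[OF assms(3)] r
    by (intro presentation_cong.append presentation_cong.refl) auto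
  then have inv: "(gword_inv r, []) \<in> presentation_cong S R"
    using gword_inv_right[OF r, of R] by simp (erule (1) presentation_cong.trans)
  obtain k where k: "free_reduce (rotate k w) \<in> {[], r, gword_inv r}"
  proof (cases "free_reduce w = []")
    case True
    then show ?thesis using that[of 0] by simp
  next
    case False
    then show ?thesis using assms(1) that unfolding relator_conjugate_def by auto
  qed
  \<comment> \<open>\<open>rotate k w\<close> cuts \<open>w\<close> after
    \<open>k mod length w\<close> letters and exchanges the two pieces.\<close>
  define u v where "u = take (k mod length w) w" and "v = drop (k mod length w) w"
  have w: "w = u @ v" "rotate k w = v @ u" by (simp_all add: u_def v_def rotate_drop_take)
  then have "u \<in> gwords S" "v \<in> gwords S" using assms(2) by auto
  then have "(v @ u, free_reduce (rotate k w)) \<in> presentation_cong S R"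
    using free_reduce_cong[of "v @ u" S R] w by simp
  moreover have "(free_reduce (rotate k w), []) \<in> presentation_cong S R"
    using k inv assms(3) presentation_cong.refl[of "[]" S R] by auto
  ultimately have "(v @ u, []) \<in> presentation_cong S R" by (rule presentation_cong.trans)
  then show ?thesis
    unfolding w(1) using \<open>u \<in> gwords S\<close> \<open>v \<in> gwords S\<close> by (rule presentation_cong_rotate)
qed


section \<open>Words in the cactus group\<close>

abbreviation cactus_cong :: "nat \<Rightarrow> ((nat \<times> nat) gword \<times> (nat \<times> nat) gword) set"
  where "cactus_cong n \<equiv> presentation_cong (cactus_gens n) (cactus_rels n)"

definition positive :: "'a list \<Rightarrow> 'a gword"
  where "positive w = map (\<lambda>x. (x, True)) w"

lemma positive_simps [simp]:
  "positive [] = []"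
  "positive (x # w) = (x, True) # positive w"
  "positive (u @ v) = positive u @ positive v"
  by (simp_all add: positive_def)

lemma positive_gwords [simp]: "positive w \<in> gwords S \<longleftrightarrow> set w \<subseteq> S"
  by (induction w) auto

lemma map_fst_positive [simp]: "map fst (positive w) = w"
  by (induction w) auto

lemma gwords_set: "w \<in> gwords S \<longleftrightarrow> set (map fst w) \<subseteq> S"
  by (induction w) auto

lemma cactus_square:
  assumes "x \<in> cactus_gens n"
  shows "(positive [x, x], []) \<in> cactus_cong n"
  using assms by (intro presentation_cong.rel) (cases x; auto simp: cactus_rels_def)+

text \<open>Generators are involutions, so x^-1 = x^-1 x x = x. Hence plain lists of generators
  represent all elements.\<close>

lemma cactus_cong_positive:
  "w \<in> gwords (cactus_gens n) \<Longrightarrow> (w, positive (map fst w)) \<in> cactus_cong n"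
proof (induction w)
  case (Cons a w)
  obtain x b where a: "a = (x, b)" by (cases a)
  have x: "x \<in> cactus_gens n" and w: "w \<in> gwords (cactus_gens n)" using Cons.prems a by auto
  have "([(x, False)] @ [], [(x, False)] @ positive [x, x]) \<in> cactus_cong n"
    using presentation_cong.sym[OF cactus_square[OF x]] x
    by (intro presentation_cong.append presentation_cong.refl) auto
  moreover have "([(x, False), (x, True)] @ [(x, True)], [] @ [(x, True)]) \<in> cactus_cong n"
    using presentation_cong.cancel[OF x, where R = "cactus_rels n" and b = False] x
    by (intro presentation_cong.append presentation_cong.refl) auto
  ultimately have "([(x, False)], [(x, True)]) \<in> cactus_cong n"
    by simp (erule (1) presentation_cong.trans)
  then have "([(x, b)], [(x, True)]) \<in> cactus_cong n"
    using x by (cases b) (auto intro: presentation_cong.refl)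
  from presentation_cong.append[OF this Cons.IH[OF w]] show ?case by (simp add: a)
qed (simp add: presentation_cong.refl)

lemma cactus_rev_left:
  "set w \<subseteq> cactus_gens n \<Longrightarrow> (positive (rev w @ w), []) \<in> cactus_cong n"
proof (induction w)
  case (Cons x w)
  then have "(positive (rev w) @ positive [x, x] @ positive w, positive (rev w) @ [] @ positive w)
    \<in> cactus_cong n"
    by (intro presentation_cong_context cactus_square) auto
  with Cons show ?case by simp (erule (1) presentation_cong.trans)
qed (simp add: presentation_cong.refl)

lemma cactus_rev_right:
  "set w \<subseteq> cactus_gens n \<Longrightarrow> (positive (w @ rev w), []) \<in> cactus_cong n"
  using cactus_rev_left[of "rev w" n] by simp

text \<open>
  The relations let \<open>s\<^bsub>p,q\<^esub>\<close> travel to the right past any \<open>s\<^bsub>m,r\<^esub>\<close> with \<open>[m,r] \<subseteq> [p,q]\<close> or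
  \<open>q < m\<close>. The resulting reduction is not confluent, but two rounds of it suffice for all the
  words met below.
\<close>

fun bubble :: "nat \<times> nat \<Rightarrow> (nat \<times> nat) list \<Rightarrow> (nat \<times> nat) list"
  where
    "bubble x [] = [x]"
  | "bubble (p, q) ((m, r) # w) =
      (if p = m \<and> q = r then w
       else if p \<le> m \<and> r \<le> q then (p + q - r, p + q - m) # bubble (p, q) w
       else if q < m then (m, r) # bubble (p, q) w
       else (p, q) # (m, r) # w)"

definition bubble_sort :: "(nat \<times> nat) list \<Rightarrow> (nat \<times> nat) list"
  where "bubble_sort w = foldr bubble w []"

text \<open>Every branch that changes the word applies one defining relation: a square cancels, an
  inner interval is reflected, or disjoint intervals commute.\<close>

lemma bubble_cong:
  "set (x # w) \<subseteq> cactus_gens n \<Longrightarrow> (positive (x # w), positive (bubble x w)) \<in> cactus_cong n"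
proof (induction x w rule: bubble.induct)
  case (1 x)
  then show ?case by (auto intro: presentation_cong.refl)
next
  case (2 p q m r w)
  have x: "(p, q) \<in> cactus_gens n" and y: "(m, r) \<in> cactus_gens n" and w: "set w \<subseteq> cactus_gens n"
    using "2.prems" by auto
  \<comment> \<open>Common part of the two moving cases: a relation takes \<open>(p, q)\<close> past
    the next letter, which becomes \<open>z\<close>, and the induction hypothesis treats the
    rest.\<close>
  have swap: "(positive ((p, q) # (m, r) # w), positive (z # bubble (p, q) w)) \<in> cactus_cong n"
    if "(positive [(p, q), (m, r)], positive [z, (p, q)]) \<in> cactus_cong n"
      and IH: "(positive ((p, q) # w), positive (bubble (p, q) w)) \<in> cactus_cong n" for z
  proof -
    have "(positive [(p, q), (m, r)] @ positive w, positive [z, (p, q)] @ positive w) \<in> cactus_cong n"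
      using that w by (intro presentation_cong.append presentation_cong.refl) auto
    moreover have "z \<in> cactus_gens n"
      using presentation_cong_gwords[OF that(1)] by simp
    then have "(positive [z] @ positive ((p, q) # w), positive [z] @ positive (bubble (p, q) w))
      \<in> cactus_cong n"
      using IH by (intro presentation_cong.append presentation_cong.refl) auto
    ultimately show ?thesis by simp (erule (1) presentation_cong.trans)
  qed
  consider (eq) "p = m" "q = r" | (sub) "\<not> (p = m \<and> q = r)" "p \<le> m" "r \<le> q"
    | (disj) "\<not> (p = m \<and> q = r)" "\<not> (p \<le> m \<and> r \<le> q)" "q < m"
    | (stuck) "\<not> (p = m \<and> q = r)" "\<not> (p \<le> m \<and> r \<le> q)" "\<not> q < m" by blast
  then show ?case
  proof cases
    case eq
    then show ?thesis
      using presentation_cong.append[OF cactus_square[OF x] presentation_cong.refl[of "positive w"]] w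
      by auto
  next
    case sub
    have "(p + q - r, p + q - m) \<in> cactus_gens n" using x y sub by (auto simp: cactus_gens_def)
    moreover have "{m..r} \<subseteq> {p..q}" using sub by auto
    ultimately have "(positive [(p, q), (m, r)], positive [(p + q - r, p + q - m), (p, q)])
      \<in> cactus_cong n"
      using x y by (intro presentation_cong.rel) (auto simp: cactus_rels_def)
    then have "(positive ((p, q) # (m, r) # w), positive ((p + q - r, p + q - m) # bubble (p, q) w))
      \<in> cactus_cong n"
      by (rule swap) (use "2.IH"(1) sub x w in simp)
    moreover have "bubble (p, q) ((m, r) # w) = (p + q - r, p + q - m) # bubble (p, q) w"
      by (simp only: bubble.simps sub if_True if_False simp_thms)
    ultimately show ?thesis by (simp only:)
  next
    case disj
    have "{p..q} \<inter> {m..r} = {}" using disj by auto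
    then have "(positive [(p, q), (m, r)], positive [(m, r), (p, q)]) \<in> cactus_cong n"
      using x y by (intro presentation_cong.rel) (auto simp: cactus_rels_def)
    then have "(positive ((p, q) # (m, r) # w), positive ((m, r) # bubble (p, q) w)) \<in> cactus_cong n"
      by (rule swap) (use "2.IH"(2) disj x w in simp)
    moreover have "bubble (p, q) ((m, r) # w) = (m, r) # bubble (p, q) w"
      by (simp only: bubble.simps disj if_True if_False simp_thms)
    ultimately show ?thesis by (simp only:)
  next
    case stuck
    have "bubble (p, q) ((m, r) # w) = (p, q) # (m, r) # w"
      by (simp only: bubble.simps stuck if_True if_False simp_thms)
    then show ?thesis using "2.prems" presentation_cong.refl positive_gwords by metis
  qed
qed

lemma bubble_sort_cong:
  "set w \<subseteq> cactus_gens n \<Longrightarrow> (positive w, positive (bubble_sort w)) \<in> cactus_cong n"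
proof (induction w)
  case (Cons x w)
  then have "([(x, True)] @ positive w, [(x, True)] @ positive (bubble_sort w)) \<in> cactus_cong n"
    by (intro presentation_cong.append presentation_cong.refl) auto
  moreover from presentation_cong_gwords[OF this]
  have "(positive (x # bubble_sort w), positive (bubble x (bubble_sort w))) \<in> cactus_cong n"
    by (intro bubble_cong) auto
  ultimately show ?case by (simp add: bubble_sort_def) (erule (1) presentation_cong.trans)
qed (simp add: bubble_sort_def presentation_cong.refl)

lemma bubble_sort_trivial:
  assumes "set w \<subseteq> cactus_gens n" "bubble_sort (bubble_sort w) = []"
  shows "(positive w, []) \<in> cactus_cong n"
proof -
  have "set (bubble_sort w) \<subseteq> cactus_gens n"
    using presentation_cong_gwords[OF bubble_sort_cong[OF assms(1)]] by simp
  then show ?thesis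
    using bubble_sort_cong[OF assms(1)] bubble_sort_cong[of "bubble_sort w" n] assms(2)
    by simp (erule (1) presentation_cong.trans)
qed


section \<open>Holonomy\<close>

definition cactus_gens4 :: "(nat \<times> nat) list"
  where "cactus_gens4 = [(1, 2), (1, 3), (1, 4), (2, 3), (2, 4), (3, 4)]"

definition surface_relator :: "nat gword"
  where "surface_relator =
    gen 1 @ gen 1 @ gen 2 @ gen 2 @ gen 3 @ gen 3 @ gen 4 @ gen 4 @ gen 5 @ gen 5"

abbreviation surface_cong :: "(nat gword \<times> nat gword) set"
  where "surface_cong \<equiv> presentation_cong {1, 2, 3, 4, 5} {(surface_relator, [])}"

text \<open>Positions count from 1, and \<open>q + 1 - p\<close> is the length of the reversed
  segment. Since positions and not entries are permuted, this is a right action.\<close>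

definition flip :: "nat \<times> nat \<Rightarrow> nat list \<Rightarrow> nat list"
  where "flip = (\<lambda>(p, q) v. take (p - 1) v @ rev (take (q + 1 - p) (drop (p - 1) v)) @ drop q v)"

definition signed_word :: "int list \<Rightarrow> nat gword"
  where "signed_word = map (\<lambda>k. (nat \<bar>k\<bar>, k > 0))"

text \<open>
  The \<open>b\<close>-edge between the orderings \<open>[x, y, z, w]\<close> and \<open>[z, y, x, w]\<close> is determined by \<open>(y, w)\<close>;
  it is oriented away from the one with \<open>x < z\<close>. A negative entry stands for an inverse letter.
\<close>

definition edge_words :: "((nat \<times> nat) \<times> nat gword) list"
  where "edge_words = map (apsnd signed_word)
    [((1, 2), [-2, -2, -1, -5]), ((1, 3), [4, 5, 5, 1, 2]), ((1, 4), []),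
     ((2, 1), [1, 2, 2, 3]), ((2, 3), [4, 5, 5, 1, 2]), ((2, 4), []),
     ((3, 1), [-5]), ((3, 2), [3]), ((3, 4), [-3, -2, -2, -1, -5]),
     ((4, 1), [3, 4]), ((4, 2), [-5, -4]), ((4, 3), [2])]"

definition edge_holonomy :: "nat list \<Rightarrow> nat gword"
  where "edge_holonomy v =
    (let w = the (map_of edge_words (v ! 1, v ! 3))
     in if v ! 0 < v ! 2 then w else gword_inv w)"

text \<open>Computed from \<open>s\<^bsub>2,4\<^esub> = cbc\<close> and \<open>s\<^bsub>2,3\<^esub> = bab\<close>; the other three generators are
  words in \<open>a\<close> and \<open>c\<close>.\<close>

definition holonomy :: "nat list \<Rightarrow> nat \<times> nat \<Rightarrow> nat gword"
  where "holonomy v x =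
    (if x = (1, 3) then edge_holonomy v
     else if x = (2, 4) then edge_holonomy (rev v)
     else if x = (2, 3) then edge_holonomy v @ edge_holonomy (flip (1, 2) (flip (1, 3) v))
     else [])"

fun path_holonomy :: "nat list \<Rightarrow> (nat \<times> nat) list \<Rightarrow> nat gword"
  where
    "path_holonomy v [] = []"
  | "path_holonomy v (x # w) = holonomy v x @ path_holonomy (flip x v) w"

text \<open>The moves \<open>(1, 2)\<close> and \<open>(1, 4)\<close> preserve the partition of an
  ordering into its first two and last two entries, so the octagons correspond to the three pairings
  of 1, 2, 3, 4. The tree keeps seven edges of each octagon. It reaches the other two octagons
  through the b-edges \<open>(2, 4)\<close> and \<open>(1, 4)\<close>, whose entries in
  \<open>edge_words\<close> are empty.\<close>

definition tree_paths :: "(nat \<times> nat) list list"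
  where "tree_paths = [r @ take k [(1, 2), (1, 4), (1, 2), (1, 4), (1, 2), (1, 4), (1, 2)].
    r \<leftarrow> [[], [(1, 3)], [(1, 2), (1, 3)]], k \<leftarrow> [0..<8]]"

text \<open>All 24 orderings, listed in the order of their tree paths so that \<open>zip\<close>
  pairs them correctly.\<close>

definition vertices :: "nat list list"
  where "vertices = map (\<lambda>t. fold flip t [1, 2, 3, 4]) tree_paths"

definition tree_path :: "nat list \<Rightarrow> (nat \<times> nat) list"
  where "tree_path v = the (map_of (zip vertices tree_paths) v)"

definition loop_words :: "(nat \<times> (nat \<times> nat) list) list"
  where "loop_words =
    [(1, [(1, 3), (3, 4), (1, 3), (2, 4), (1, 2), (1, 3), (3, 4), (2, 3), (3, 4), (1, 3)]),
     (2, [(1, 3), (3, 4), (2, 3), (3, 4), (2, 4), (1, 3)]),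
     (3, [(1, 2), (1, 3), (3, 4), (1, 2), (1, 3), (3, 4), (1, 4)]),
     (4, [(3, 4), (1, 2), (2, 4), (1, 3), (1, 4)]),
     (5, [(2, 3), (2, 4), (1, 2), (2, 4), (1, 4)])]"

text \<open>Reversal inverts, the generators being involutions.\<close>

definition loop_letter :: "nat \<times> bool \<Rightarrow> (nat \<times> nat) list"
  where "loop_letter = (\<lambda>(i, b). let w = the (map_of loop_words i) in if b then w else rev w)"

definition loop_word :: "nat gword \<Rightarrow> (nat \<times> nat) list"
  where "loop_word u = concat (map loop_letter u)"

text \<open>A sufficient criterion for two paths from \<open>v\<close> to have the same endpoint
  and, modulo the surface relator, the same holonomy.\<close>

definition balanced :: "nat list \<Rightarrow> (nat \<times> nat) list \<Rightarrow> (nat \<times> nat) list \<Rightarrow> bool"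
  where "balanced v w w' \<longleftrightarrow>
    fold flip w v = fold flip w' v \<and>
    relator_conjugate surface_relator (path_holonomy v w @ gword_inv (path_holonomy v w'))"

section \<open>Finite verifications by evaluation\<close>

lemma balanced_square: "\<forall>v\<in>set vertices. \<forall>x\<in>set cactus_gens4. balanced v [x, x] []"
  by code_simp

text \<open>These are the only disjoint intervals with at least two elements each in [1,4]; the
  opposite order follows by symmetry.\<close>

lemma balanced_disjoint: "\<forall>v\<in>set vertices. balanced v [(1, 2), (3, 4)] [(3, 4), (1, 2)]"
  by code_simp

lemma balanced_nested:
  "\<forall>v\<in>set vertices. \<forall>(p, q)\<in>set cactus_gens4. \<forall>(m, r)\<in>set cactus_gens4.
    if p \<le> m \<and> r \<le> q then balanced v [(p, q), (m, r)] [(p + q - r, p + q - m), (p, q)] else True"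
  by code_simp

lemma vertices_flip: "\<forall>v\<in>set vertices. \<forall>x\<in>set cactus_gens4. flip x v \<in> set vertices"
  by code_simp

lemma holonomy_letters:
  "\<forall>v\<in>set vertices. \<forall>x\<in>set cactus_gens4. \<forall>(i, b)\<in>set (holonomy v x). i \<in> {1, 2, 3, 4, 5}"
  by code_simp

lemma tree_path_letters: "\<forall>v\<in>set vertices. \<forall>x\<in>set (tree_path v). x \<in> set cactus_gens4"
  by code_simp

lemma tree_path_base: "[1, 2, 3, 4] \<in> set vertices \<and> tree_path [1, 2, 3, 4] = []"
  by code_simp

text \<open>Schreier generators: following the tree to \<open>v\<close>, crossing the edge
  \<open>x\<close> and returning along the tree gives the loop word of that edge's holonomy. The
  inverse loop word in front turns the claim into one of triviality.\<close>

lemma tree_path_step: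
  "\<forall>v\<in>set vertices. \<forall>x\<in>set cactus_gens4.
    bubble_sort (bubble_sort (rev (loop_word (holonomy v x)) @ (tree_path v @ [x]) @
      rev (tree_path (flip x v)))) = []"
  by code_simp

lemma loop_letter_letters:
  "\<forall>i\<in>set [1, 2, 3, 4, 5]. \<forall>x\<in>set (loop_letter (i, True)). x \<in> set cactus_gens4"
  by code_simp

text \<open>Each chosen loop closes up at the standard ordering, and its holonomy gives back its
  letter modulo the surface relator.\<close>

lemma loop_letter_holonomy:
  "\<forall>i\<in>set [1, 2, 3, 4, 5]. \<forall>b\<in>set [True, False].
    fold flip (loop_letter (i, b)) [1, 2, 3, 4] = [1, 2, 3, 4] \<and>
    relator_conjugate surface_relator
      (path_holonomy [1, 2, 3, 4] (loop_letter (i, b)) @ gword_inv [(i, b)])"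
  by code_simp

text \<open>Makes the assignment of loops to letters extend to a homomorphism.\<close>

lemma surface_relator_loop: "bubble_sort (bubble_sort (loop_word surface_relator)) = []"
  by code_simp

declare One_nat_def [simp del]

lemma cactus_gens_4: "cactus_gens 4 = set cactus_gens4"
proof -
  have "p = 1 \<and> q \<in> {2, 3, 4} \<or> p = 2 \<and> q \<in> {3, 4} \<or> p = 3 \<and> q = 4"
    if "1 \<le> p" "p < q" "q \<le> 4" for p q :: nat
    using that by auto
  then show ?thesis by (auto simp: cactus_gens_def cactus_gens4_def)
qed

section \<open>From the finite verifications to arbitrary words\<close>

lemma path_holonomy_append:
  "path_holonomy v (u @ w) = path_holonomy v u @ path_holonomy (fold flip u v) w"
  by (induction u arbitrary: v) auto

lemma vertices_fold:
  "v \<in> set vertices \<Longrightarrow> set w \<subseteq> cactus_gens 4 \<Longrightarrow> fold flip w v \<in> set vertices"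
proof (induction w arbitrary: v)
  case (Cons x w)
  then have "flip x v \<in> set vertices"
    using vertices_flip unfolding cactus_gens_4 by simp
  with Cons show ?case by simp
qed simp

lemma holonomy_closed:
  assumes "v \<in> set vertices" "x \<in> cactus_gens 4"
  shows "holonomy v x \<in> gwords {1, 2, 3, 4, 5}"
proof -
  have "\<forall>(i, b)\<in>set (holonomy v x). i \<in> {1, 2, 3, 4, 5}"
    using holonomy_letters assms unfolding cactus_gens_4 by blast
  then show ?thesis by (auto simp: gwords_set)
qed

lemma path_holonomy_closed:
  "v \<in> set vertices \<Longrightarrow> set w \<subseteq> cactus_gens 4 \<Longrightarrow> path_holonomy v w \<in> gwords {1, 2, 3, 4, 5}"
proof (induction w arbitrary: v)
  case (Cons x w)
  then have "flip x v \<in> set vertices" using vertices_fold[of v "[x]"] by simp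
  with Cons show ?case using holonomy_closed by simp
qed simp

lemma surface_relator_cong: "(surface_relator, []) \<in> surface_cong"
  by (rule presentation_cong.rel) (simp_all add: surface_relator_def)

lemma balanced_holonomy:
  assumes "balanced v u w" "v \<in> set vertices" "set u \<subseteq> cactus_gens 4" "set w \<subseteq> cactus_gens 4"
  shows "fold flip u v = fold flip w v \<and> (path_holonomy v u, path_holonomy v w) \<in> surface_cong"
proof
  show "fold flip u v = fold flip w v" using assms(1) by (simp add: balanced_def)
  have closed: "path_holonomy v u \<in> gwords {1, 2, 3, 4, 5}" "path_holonomy v w \<in> gwords {1, 2, 3, 4, 5}"
    using path_holonomy_closed assms by blast+
  have "(path_holonomy v u @ gword_inv (path_holonomy v w), []) \<in> surface_cong"
    by (rule relator_conjugate_trivial[OF _ _ surface_relator_cong])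
      (use assms(1) closed in \<open>simp_all add: balanced_def\<close>)
  then show "(path_holonomy v u, path_holonomy v w) \<in> surface_cong"
    by (rule presentation_cong_if_quotient_trivial[OF _ closed])
qed

lemma path_holonomy_rel:
  assumes "(u, w) \<in> cactus_rels 4" "v \<in> set vertices"
    and "u \<in> gwords (cactus_gens 4)" "w \<in> gwords (cactus_gens 4)"
  shows "fold flip (map fst u) v = fold flip (map fst w) v \<and>
    (path_holonomy v (map fst u), path_holonomy v (map fst w)) \<in> surface_cong"
proof -
  have closed: "set (map fst u) \<subseteq> cactus_gens 4" "set (map fst w) \<subseteq> cactus_gens 4"
    using assms(3,4) unfolding gwords_set by blast+
  show ?thesis
    using assms(1) unfolding cactus_rels_def
  proof (elim UnE CollectE exE conjE Pair_inject)
    fix p q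
    assume u: "u = gen (p, q) @ gen (p, q)" "w = []" and "(p, q) \<in> cactus_gens 4"
    then have "balanced v (map fst u) (map fst w)"
      using balanced_square assms(2) unfolding cactus_gens_4 by simp
    then show ?thesis using balanced_holonomy assms(2) closed by blast
  next
    fix p q m r
    assume u: "u = gen (p, q) @ gen (m, r)" "w = gen (m, r) @ gen (p, q)"
      and gens: "(p, q) \<in> cactus_gens 4" "(m, r) \<in> cactus_gens 4"
      and "{p..q} \<inter> {m..r} = {}"
    then have "q < m \<or> r < p" by (auto simp: cactus_gens_def)
    then have "(p, q) = (1, 2) \<and> (m, r) = (3, 4) \<or> (p, q) = (3, 4) \<and> (m, r) = (1, 2)"
      using gens by (auto simp: cactus_gens_def)
    moreover have "fold flip [(1, 2), (3, 4)] v = fold flip [(3, 4), (1, 2)] v \<and>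
      (path_holonomy v [(1, 2), (3, 4)], path_holonomy v [(3, 4), (1, 2)]) \<in> surface_cong"
      using balanced_disjoint assms(2)
      by (intro balanced_holonomy) (auto simp: cactus_gens_def)
    moreover have "map fst u = [(p, q), (m, r)]" "map fst w = [(m, r), (p, q)]"
      by (simp_all add: u)
    ultimately show ?thesis by (metis presentation_cong.sym)
  next
    fix p q m r
    assume u: "u = gen (p, q) @ gen (m, r)" "w = gen (p + q - r, p + q - m) @ gen (p, q)"
      and gens: "(p, q) \<in> cactus_gens 4" "(m, r) \<in> cactus_gens 4"
      and "{m..r} \<subseteq> {p..q}"
    then have "p \<le> m \<and> r \<le> q" by (auto simp: cactus_gens_def)
    moreover have "if p \<le> m \<and> r \<le> q
      then balanced v [(p, q), (m, r)] [(p + q - r, p + q - m), (p, q)] else True"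
      using balanced_nested assms(2) gens unfolding cactus_gens_4 by blast
    ultimately have "balanced v (map fst u) (map fst w)" by (simp add: u)
    then show ?thesis using balanced_holonomy assms(2) closed by blast
  qed
qed

text \<open>Holonomy is well defined on elements of the cactus group, because every defining
  relation has been checked at every vertex.\<close>

lemma path_holonomy_cong:
  "(u, w) \<in> cactus_cong 4 \<Longrightarrow> v \<in> set vertices \<Longrightarrow>
    fold flip (map fst u) v = fold flip (map fst w) v \<and>
    (path_holonomy v (map fst u), path_holonomy v (map fst w)) \<in> surface_cong"
proof (induction arbitrary: v rule: presentation_cong.induct)
  case (refl w)
  then show ?case
    using path_holonomy_closed[OF refl(2)] by (simp add: gwords_set presentation_cong.refl)
next
  case (sym u v)
  then show ?case by (metis presentation_cong.sym)
next
  case (trans u v w)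
  then show ?case by (metis presentation_cong.trans)
next
  case (append u u' w w')
  have "set (map fst u) \<subseteq> cactus_gens 4"
    using presentation_cong_gwords[OF append.hyps(1)] by (simp only: gwords_set)
  \<comment> \<open>The second factor starts where the first path ends, hence the induction for all
    \<open>v\<close> at once.\<close>
  then have "fold flip (map fst u) v \<in> set vertices"
    using vertices_fold append.prems by blast
  with append.IH append.prems show ?case
    by (simp add: path_holonomy_append) (metis presentation_cong.append)
next
  case (cancel x b)
  \<comment> \<open>Without signs, both cancelling pairs become the square of
    \<open>x\<close>.\<close>
  then show ?case
    using balanced_holonomy[of v "[x, x]" "[]"] balanced_square by (simp add: cactus_gens_4)
next
  case (rel u w)
  then show ?case using path_holonomy_rel by blast
qed

lemma tree_path_closed: "v \<in> set vertices \<Longrightarrow> set (tree_path v) \<subseteq> cactus_gens 4"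
  using tree_path_letters unfolding cactus_gens_4 by blast

lemma loop_word_simps [simp]:
  "loop_word [] = []"
  "loop_word (a # u) = loop_letter a @ loop_word u"
  "loop_word (u @ w) = loop_word u @ loop_word w"
  by (simp_all add: loop_word_def)

lemma loop_letter_closed: "i \<in> {1, 2, 3, 4, 5} \<Longrightarrow> set (loop_letter (i, b)) \<subseteq> cactus_gens 4"
proof -
  assume "i \<in> {1, 2, 3, 4, 5}"
  then have "set (loop_letter (i, True)) \<subseteq> cactus_gens 4"
    using loop_letter_letters by (simp add: cactus_gens_4 subset_iff) blast
  moreover have "set (loop_letter (i, b)) = set (loop_letter (i, True))"
    by (simp add: loop_letter_def Let_def)
  ultimately show ?thesis by simp
qed

lemma loop_word_closed: "u \<in> gwords {1, 2, 3, 4, 5} \<Longrightarrow> set (loop_word u) \<subseteq> cactus_gens 4"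
proof (induction u)
  case (Cons a u)
  then show ?case using loop_letter_closed by (cases a) auto
qed simp

text \<open>Multiplying by \<open>a\<close> on the left and by \<open>c\<close> on the right
  isolates \<open>b\<close>.\<close>

lemma cactus_cong_rev:
  assumes "(positive (rev a @ b @ rev c), []) \<in> cactus_cong n"
    and "set a \<subseteq> cactus_gens n" "set b \<subseteq> cactus_gens n" "set c \<subseteq> cactus_gens n"
  shows "(positive b, positive (a @ c)) \<in> cactus_cong n"
proof -
  have "(positive a @ positive (rev a @ b @ rev c) @ positive c, positive a @ [] @ positive c)
    \<in> cactus_cong n"
    using assms by (intro presentation_cong_context) auto
  moreover have "(positive (a @ rev a) @ positive b @ positive (rev c @ c), [] @ positive b @ [])
    \<in> cactus_cong n"
    using assms by (intro presentation_cong.append presentation_cong.refl cactus_rev_left cactus_rev_right)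
      auto
  ultimately show ?thesis
    by simp (metis presentation_cong.sym presentation_cong.trans)
qed

text \<open>Telescopes \<open>tree_path_step\<close> along \<open>w\<close>, the tree paths at
  intermediate vertices cancelling. For a loop at the standard ordering it recovers the loop from
  its holonomy, which yields surjectivity.\<close>

lemma tree_path_holonomy:
  "v \<in> set vertices \<Longrightarrow> set w \<subseteq> cactus_gens 4 \<Longrightarrow>
    (positive (tree_path v @ w), positive (loop_word (path_holonomy v w) @ tree_path (fold flip w v)))
      \<in> cactus_cong 4"
proof (induction w arbitrary: v)
  case Nil
  then show ?case using tree_path_closed by (simp add: presentation_cong.refl)
next
  case (Cons x w)
  have x: "x \<in> cactus_gens 4" and w: "set w \<subseteq> cactus_gens 4" using Cons.prems by auto
  have v: "flip x v \<in> set vertices" using vertices_fold[of v "[x]"] Cons.prems(1) x by simp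
  have L: "set (loop_word (holonomy v x)) \<subseteq> cactus_gens 4"
    using loop_word_closed holonomy_closed Cons.prems(1) x by blast
  have "(positive (rev (loop_word (holonomy v x)) @ (tree_path v @ [x]) @ rev (tree_path (flip x v))), [])
    \<in> cactus_cong 4"
    using L tree_path_closed[OF Cons.prems(1)] tree_path_closed[OF v] x tree_path_step Cons.prems(1)
    by (intro bubble_sort_trivial) (auto simp: cactus_gens_4)
  then have "(positive (tree_path v @ [x]), positive (loop_word (holonomy v x) @ tree_path (flip x v)))
    \<in> cactus_cong 4"
    using L tree_path_closed[OF Cons.prems(1)] tree_path_closed[OF v] x
    by (intro cactus_cong_rev) auto
  then have "(positive (tree_path v @ [x]) @ positive w,
      positive (loop_word (holonomy v x) @ tree_path (flip x v)) @ positive w) \<in> cactus_cong 4"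
    using w by (intro presentation_cong.append presentation_cong.refl) auto
  moreover have "(positive (loop_word (holonomy v x)) @ positive (tree_path (flip x v) @ w),
      positive (loop_word (holonomy v x)) @
        positive (loop_word (path_holonomy (flip x v) w) @ tree_path (fold flip w (flip x v))))
    \<in> cactus_cong 4"
    using L Cons.IH[OF v w] by (intro presentation_cong.append presentation_cong.refl) auto
  ultimately show ?case by simp (erule (1) presentation_cong.trans)
qed

text \<open>The other composite, which yields injectivity. Every loop returns to the standard
  ordering, so the letters can be treated one at a time.\<close>

lemma loop_word_holonomy:
  "u \<in> gwords {1, 2, 3, 4, 5} \<Longrightarrow>
    fold flip (loop_word u) [1, 2, 3, 4] = [1, 2, 3, 4] \<and>
    (path_holonomy [1, 2, 3, 4] (loop_word u), u) \<in> surface_cong"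
proof (induction u)
  case (Cons a u)
  obtain i b where a: "a = (i, b)" by (cases a)
  have i: "i \<in> {1, 2, 3, 4, 5}" and u: "u \<in> gwords {1, 2, 3, 4, 5}" using Cons.prems a by auto
  have loop: "fold flip (loop_letter a) [1, 2, 3, 4] = [1, 2, 3, 4]"
    and conj: "relator_conjugate surface_relator
      (path_holonomy [1, 2, 3, 4] (loop_letter a) @ gword_inv [a])"
    using loop_letter_holonomy i unfolding a by fastforce+
  have closed: "path_holonomy [1, 2, 3, 4] (loop_letter a) \<in> gwords {1, 2, 3, 4, 5}"
    using path_holonomy_closed tree_path_base loop_letter_closed[OF i] a by blast
  have "(path_holonomy [1, 2, 3, 4] (loop_letter a) @ gword_inv [a], []) \<in> surface_cong"
    by (rule relator_conjugate_trivial[OF conj _ surface_relator_cong]) (use closed a i in simp)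
  then have "(path_holonomy [1, 2, 3, 4] (loop_letter a), [a]) \<in> surface_cong"
    by (rule presentation_cong_if_quotient_trivial) (use closed a i in simp_all)
  from presentation_cong.append[OF this conjunct2[OF Cons.IH[OF u]]] Cons.IH[OF u] loop
  show ?case by (simp add: path_holonomy_append)
qed (simp add: presentation_cong.refl)


section \<open>The isomorphism\<close>

abbreviation cactus_class :: "(nat \<times> nat) list \<Rightarrow> (nat \<times> nat) gword set"
  where "cactus_class w \<equiv> cactus_cong 4 `` {positive w}"

lemma cactus_class_eq_iff:
  assumes "set u \<subseteq> cactus_gens 4" "set w \<subseteq> cactus_gens 4"
  shows "cactus_class u = cactus_class w \<longleftrightarrow> (positive u, positive w) \<in> cactus_cong 4"
  by (rule eq_equiv_class_iff[OF equiv_presentation_cong]) (use assms in simp_all)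

lemma cactus_class_mult:
  "set u \<subseteq> cactus_gens 4 \<Longrightarrow> set w \<subseteq> cactus_gens 4 \<Longrightarrow>
    cactus_class u \<otimes>\<^bsub>cactus_group 4\<^esub> cactus_class w = cactus_class (u @ w)"
  by (simp add: cactus_group_def presented_group_mult_class)

lemma cactus_class_one: "\<one>\<^bsub>cactus_group 4\<^esub> = cactus_class []"
  by (simp add: cactus_group_def presented_group_def)

lemma cactus_class_carrier: "set w \<subseteq> cactus_gens 4 \<Longrightarrow> cactus_class w \<in> carrier (cactus_group 4)"
  by (simp add: cactus_group_def presented_group_class_in_carrier)

lemma cactus_class_inv:
  assumes "set w \<subseteq> cactus_gens 4"
  shows "inv\<^bsub>cactus_group 4\<^esub> cactus_class w = cactus_class (rev w)"
proof (rule group.inv_equality[OF group_cactus_group])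
  show "cactus_class (rev w) \<otimes>\<^bsub>cactus_group 4\<^esub> cactus_class w = \<one>\<^bsub>cactus_group 4\<^esub>"
    using assms cactus_class_eq_iff[of "rev w @ w" "[]"] cactus_rev_left[OF assms]
    by (simp add: cactus_class_mult cactus_class_one)
qed (use assms in \<open>simp_all add: cactus_class_carrier\<close>)

section \<open>Orderings as permutations, and the kernel of the projection\<close>

lemma flip_interval_reversal:
  assumes "x \<in> cactus_gens 4" "length v = 4"
  shows "flip x v = map (\<lambda>i. v ! (interval_reversal x i - 1)) [1, 2, 3, 4]"
proof -
  obtain a b c d where "v = [a, b, c, d]"
    using assms(2) by (auto simp: numeral_eq_Suc length_Suc_conv)
  moreover have "x \<in> {(1, 2), (1, 3), (1, 4), (2, 3), (2, 4), (3, 4)}"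
    using assms(1) by (simp add: cactus_gens_4 cactus_gens4_def)
  ultimately show ?thesis
    by (auto simp: flip_def interval_reversal_def numeral_eq_Suc)
qed

text \<open>Each flip precomposes with its reversal, so the first letter of \<open>w\<close> becomes
  the outermost permutation, as in the product of \<open>sym_group\<close>. The shift by 1 converts
  positions to list indices.\<close>

lemma fold_flip_eval:
  assumes "set w \<subseteq> cactus_gens 4" "length v = 4"
  shows "fold flip w v =
    map (\<lambda>i. v ! (gword_eval (sym_group 4) interval_reversal (positive w) i - 1)) [1, 2, 3, 4]"
  using assms
proof (induction w arbitrary: v)
  case Nil
  then obtain a b c d where "v = [a, b, c, d]"
    by (auto simp: numeral_eq_Suc length_Suc_conv)
  then show ?case by (simp add: sym_group_one numeral_eq_Suc)
next
  case (Cons x w)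
  let ?e = "gword_eval (sym_group 4) interval_reversal (positive w)"
  have "?e \<in> carrier (sym_group 4)"
    using Cons.prems interval_reversal_permutes
    by (intro group.gword_eval_closed[OF sym_group_is_group, of "cactus_gens 4"])
      (auto simp: sym_group_carrier simp del: One_nat_def)
  \<comment> \<open>Keeps the shifted values valid as list indices.\<close>
  then have e: "?e i \<in> {1..4}" if "i \<in> {1..4}" for i
    using that permutes_in_image unfolding sym_group_carrier by metis
  have v: "flip x v = map (\<lambda>i. v ! (interval_reversal x i - 1)) [1, 2, 3, 4]"
    using Cons.prems by (intro flip_interval_reversal) auto
  then have nth: "flip x v ! (j - 1) = v ! (interval_reversal x j - 1)" if "j \<in> {1..4}" for j
  proof -
    have "j = 1 \<or> j = 2 \<or> j = 3 \<or> j = 4" using that by auto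
    then show ?thesis by (elim disjE) (simp_all add: v)
  qed
  have "fold flip (x # w) v = map (\<lambda>i. flip x v ! (?e i - 1)) [1, 2, 3, 4]"
    using Cons.IH[of "flip x v"] Cons.prems v by simp
  also have "\<dots> = map (\<lambda>i. v ! (interval_reversal x (?e i) - 1)) [1, 2, 3, 4]"
    by (intro map_cong HOL.refl nth e) auto
  finally show ?case by (simp add: sym_group_mult)
qed

text \<open>Started at the standard ordering, the flips produce the one-line notation of the image
  of \<open>w\<close> in the symmetric group.\<close>

lemma cactus_class_pure_iff:
  assumes "set w \<subseteq> cactus_gens 4"
  shows "cactus_class w \<in> carrier (pure_cactus_group 4) \<longleftrightarrow>
    fold flip w [1, 2, 3, 4] = [1, 2, 3, 4]"
proof -
  let ?e = "gword_eval (sym_group 4) interval_reversal (positive w)"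
  have carr: "interval_reversal x \<in> carrier (sym_group 4)" if "x \<in> cactus_gens 4" for x
    using that interval_reversal_permutes by (cases x) (simp add: sym_group_carrier del: One_nat_def)
  have "cactus_to_sym 4 (cactus_class w) = ?e"
    unfolding cactus_to_sym_def
    by (rule group.presentation_lift_class[OF sym_group_is_group carr interval_reversal_respects_rels])
      (use assms in simp_all)
  then have pure: "cactus_class w \<in> carrier (pure_cactus_group 4) \<longleftrightarrow> ?e = id"
    using cactus_class_carrier[OF assms]
    by (simp add: pure_cactus_group_def kernel_def sym_group_one)
  have "?e \<in> carrier (sym_group 4)"
    using assms carr by (intro group.gword_eval_closed[OF sym_group_is_group, of "cactus_gens 4"]) auto
  then have e: "?e permutes {1..4}" by (simp only: sym_group_carrier)
  have nth: "[1, 2, 3, 4] ! (?e i - 1) = ?e i" if "i \<in> {1..4}" for i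
  proof -
    have "?e i \<in> {1..4}" using permutes_in_image[OF e] that by blast
    then have "?e i = 1 \<or> ?e i = 2 \<or> ?e i = 3 \<or> ?e i = 4" by auto
    then show ?thesis by (elim disjE) simp_all
  qed
  have "fold flip w [1, 2, 3, 4] = map (\<lambda>i. [1, 2, 3, 4] ! (?e i - 1)) [1, 2, 3, 4]"
    by (rule fold_flip_eval[OF assms]) simp
  also have "\<dots> = map ?e [1, 2, 3, 4]"
    by (intro map_cong HOL.refl nth) auto
  finally have "fold flip w [1, 2, 3, 4] = map ?e [1, 2, 3, 4]" .
  moreover have "map ?e [1, 2, 3, 4] = [1, 2, 3, 4] \<longleftrightarrow> ?e = id"
  proof
    assume *: "map ?e [1, 2, 3, 4] = [1, 2, 3, 4]"
    show "?e = id"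
    proof
      fix i
      show "?e i = id i"
      proof (cases "i \<in> {1..4}")
        case True
        then have "i = 1 \<or> i = 2 \<or> i = 3 \<or> i = 4" by auto
        with * show ?thesis by auto
      qed (use e in \<open>simp add: permutes_not_in\<close>)
    qed
  qed simp
  ultimately show ?thesis using pure by simp
qed

section \<open>The map from the surface group and its bijectivity\<close>

definition surface_to_cactus :: "nat gword set \<Rightarrow> (nat \<times> nat) gword set"
  where "surface_to_cactus =
    presentation_lift (cactus_group 4) (\<lambda>i. cactus_class (loop_letter (i, True)))"

lemma gword_eval_loop_word:
  "u \<in> gwords {1, 2, 3, 4, 5} \<Longrightarrow>
    gword_eval (cactus_group 4) (\<lambda>i. cactus_class (loop_letter (i, True))) u = cactus_class (loop_word u)"
proof (induction u)
  case Nil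
  then show ?case by (simp add: cactus_class_one)
next
  case (Cons a u)
  obtain i b where a: "a = (i, b)" by (cases a)
  have i: "i \<in> {1, 2, 3, 4, 5}" and u: "u \<in> gwords {1, 2, 3, 4, 5}" using Cons.prems a by auto
  have "loop_letter (i, False) = rev (loop_letter (i, True))"
    by (simp add: loop_letter_def Let_def)
  then have "(if b then cactus_class (loop_letter (i, True))
      else inv\<^bsub>cactus_group 4\<^esub> cactus_class (loop_letter (i, True))) = cactus_class (loop_letter a)"
    using cactus_class_inv[OF loop_letter_closed[OF i]] a by simp
  then show ?case
    using Cons.IH[OF u] loop_letter_closed[OF i] loop_word_closed[OF u] a
    by (simp only: gword_eval.simps cactus_class_mult loop_word_simps)
qed

lemma surface_relator_eval:
  assumes "(u, w) \<in> {(surface_relator, [])}"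
  shows "gword_eval (cactus_group 4) (\<lambda>i. cactus_class (loop_letter (i, True))) u =
    gword_eval (cactus_group 4) (\<lambda>i. cactus_class (loop_letter (i, True))) w"
proof -
  have r: "surface_relator \<in> gwords {1, 2, 3, 4, 5}" by (simp add: surface_relator_def)
  have "(positive (loop_word surface_relator), positive []) \<in> cactus_cong 4"
    using bubble_sort_trivial[OF loop_word_closed[OF r] surface_relator_loop] by simp
  then have "cactus_class (loop_word surface_relator) = cactus_class []"
    using cactus_class_eq_iff[of "loop_word surface_relator" "[]"] loop_word_closed[OF r] by simp
  then show ?thesis using assms gword_eval_loop_word[OF r] cactus_class_one by simp
qed

lemma surface_to_cactus_class:
  assumes "u \<in> gwords {1, 2, 3, 4, 5}"
  shows "surface_to_cactus (surface_cong `` {u}) = cactus_class (loop_word u)"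
proof -
  have "surface_to_cactus (surface_cong `` {u}) =
    gword_eval (cactus_group 4) (\<lambda>i. cactus_class (loop_letter (i, True))) u"
    unfolding surface_to_cactus_def
    by (rule group.presentation_lift_class[OF group_cactus_group _ surface_relator_eval assms])
      (auto intro: cactus_class_carrier[OF loop_letter_closed])
  then show ?thesis using gword_eval_loop_word[OF assms] by simp
qed

lemma surface_to_cactus_iso:
  "surface_to_cactus \<in> iso (presented_group {1, 2, 3, 4, 5} {(surface_relator, [])}) (pure_cactus_group 4)"
    (is "_ \<in> iso ?G _")
  unfolding iso_iff
proof (intro conjI)
  have hom: "surface_to_cactus \<in> hom ?G (cactus_group 4)"
    unfolding surface_to_cactus_def
    by (rule group.presentation_lift_hom[OF group_cactus_group _ surface_relator_eval])
      (auto intro: cactus_class_carrier[OF loop_letter_closed])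
  have base: "[1, 2, 3, 4] \<in> set vertices" using tree_path_base by blast
  have pure: "cactus_class (loop_word u) \<in> carrier (pure_cactus_group 4)"
    if "u \<in> gwords {1, 2, 3, 4, 5}" for u
    using cactus_class_pure_iff loop_word_closed loop_word_holonomy that by blast
  then have into: "surface_to_cactus A \<in> carrier (pure_cactus_group 4)" if "A \<in> carrier ?G" for A
    using that by (elim presented_group_carrier_cases) (simp add: surface_to_cactus_class)
  \<comment> \<open>The pure cactus group inherits its product from the cactus group, so only the
    range has to be restricted.\<close>
  show "surface_to_cactus \<in> hom ?G (pure_cactus_group 4)"
    using hom into by (auto simp: hom_def pure_cactus_group_def)
  show "inj_on surface_to_cactus (carrier ?G)"
  proof (rule inj_onI)
    fix A B assume AB: "A \<in> carrier ?G" "B \<in> carrier ?G" "surface_to_cactus A = surface_to_cactus B"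
    obtain u where u: "u \<in> gwords {1, 2, 3, 4, 5}" "A = surface_cong `` {u}"
      using AB(1) by (rule presented_group_carrier_cases)
    obtain w where w: "w \<in> gwords {1, 2, 3, 4, 5}" "B = surface_cong `` {w}"
      using AB(2) by (rule presented_group_carrier_cases)
    have "(positive (loop_word u), positive (loop_word w)) \<in> cactus_cong 4"
      using AB(3) u w cactus_class_eq_iff loop_word_closed by (simp add: surface_to_cactus_class)
    \<comment> \<open>Holonomy at the standard ordering is a left inverse of
      \<open>loop_word\<close> up to congruence.\<close>
    from path_holonomy_cong[OF this base]
    have "(path_holonomy [1, 2, 3, 4] (loop_word u), path_holonomy [1, 2, 3, 4] (loop_word w))
      \<in> surface_cong" by simp
    from presentation_cong.trans[OF presentation_cong.trans[OF
        presentation_cong.sym[OF conjunct2[OF loop_word_holonomy[OF u(1)]]] this]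
        conjunct2[OF loop_word_holonomy[OF w(1)]]]
    have "(u, w) \<in> surface_cong" .
    then show "A = B" using u w equiv_class_eq[OF equiv_presentation_cong] by blast
  qed
  show "surface_to_cactus ` carrier ?G = carrier (pure_cactus_group 4)"
  proof (intro equalityI subsetI)
    fix A assume A: "A \<in> carrier (pure_cactus_group 4)"
    then have "A \<in> carrier (presented_group (cactus_gens 4) (cactus_rels 4))"
      by (simp add: pure_cactus_group_def kernel_def cactus_group_def)
    then obtain w where w: "w \<in> gwords (cactus_gens 4)" "A = cactus_cong 4 `` {w}"
      by (rule presented_group_carrier_cases)
    let ?w = "map fst w"
    have w': "set ?w \<subseteq> cactus_gens 4" using w(1) by (simp only: gwords_set)
    have Aw: "A = cactus_class ?w"
      using w cactus_cong_positive equiv_class_eq[OF equiv_presentation_cong] by blast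
    then have "fold flip ?w [1, 2, 3, 4] = [1, 2, 3, 4]"
      using A cactus_class_pure_iff[OF w'] by simp
    \<comment> \<open>The tree path at the standard ordering is empty, so a closed word equals the
      loop word of its own holonomy, which supplies the preimage.\<close>
    then have "(positive ?w, positive (loop_word (path_holonomy [1, 2, 3, 4] ?w))) \<in> cactus_cong 4"
      using tree_path_holonomy[OF base w'] tree_path_base by simp
    moreover have u: "path_holonomy [1, 2, 3, 4] ?w \<in> gwords {1, 2, 3, 4, 5}"
      using path_holonomy_closed[OF base w'] .
    ultimately have "A = surface_to_cactus (surface_cong `` {path_holonomy [1, 2, 3, 4] ?w})"
      unfolding surface_to_cactus_class[OF u] Aw
      using cactus_class_eq_iff[OF w' loop_word_closed[OF u]] by blast
    then show "A \<in> surface_to_cactus ` carrier ?G"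
      using presented_group_class_in_carrier[OF u] by blast
  qed (use into in blast)
qed

theorem corollary1p3:
  shows "pure_cactus_group 4 \<cong>
    presented_group {1, 2, 3, 4, 5 :: nat}
      {(gen 1 @ gen 1 @ gen 2 @ gen 2 @ gen 3 @ gen 3 @ gen 4 @ gen 4 @ gen 5 @ gen 5, [])}"
  using group.iso_sym[OF group_presented_group is_isoI[OF surface_to_cactus_iso]]
  unfolding surface_relator_def .

end
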